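(* Let $\Lambda_5$ be the lattice with basis $e_1,\dots,e_5$ and Gram matrix $2\begin{pmatrix}2&-1&0&0&0\\-1&2&-1&0&0\\0&-1&2&-1&-1\\0&0&-1&2&0\\0&0&-1&0&2\end{pmatrix}$, and let $f_1=\tfrac12(e_1+2e_2+2e_3+e_4+e_5)$. Every integral lattice $M$ in $\mathbb{R}\Lambda_5$ with $\Lambda_5\subseteq M$ is isometric to one of the eight lattices $\Lambda_5$, $\Lambda_5(\tfrac12 e_1)$, $\Lambda_5(\tfrac12(e_1+e_3))$, $\Lambda_5(\tfrac12(e_4+e_5))$, $\Lambda_5(\tfrac12 e_1,\tfrac12 e_3)$, $\Lambda_5(\tfrac12 e_1,f_1)$, $\Lambda_5(\tfrac12(e_1+e_3),\tfrac12(e_4+e_5))$, $\Lambda_5(\tfrac12 e_1,\tfrac12 e_3,f_1)$.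
   Context: A lattice is integral if all inner products of its vectors are integers. For a lattice $L$ and vectors $x_1,\dots,x_k$ in $\mathbb{R}L$, $L(x_1,\dots,x_k)$ denotes the lattice generated by $L$ and the $x_i$. *)

theory Defs
  imports "HOL-Analysis.Analysis"
begin

text \<open>The subgroup generated by a set of vectors, i.e. its span over the integers.\<close>

definition int_span :: "'a::real_vector set \<Rightarrow> 'a set" where
  "int_span = module.span (\<lambda>(k::int) x. real_of_int k *\<^sub>R x)"

lemma module_int_scaleR: "module (\<lambda>(k::int) (x::'a::real_vector). real_of_int k *\<^sub>R x)"
  by unfold_locales (simp_all add: algebra_simps)

text \<open>The linear independence below is over the reals.  A lattice need not have full rank in
  the ambient space.\<close>

definition lattice_basis :: "('i::finite \<Rightarrow> 'a::euclidean_space) \<Rightarrow> 'a set \<Rightarrow> bool" where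
  "lattice_basis e L \<longleftrightarrow> inj e \<and> independent (range e) \<and> L = int_span (range e)"

definition is_lattice :: "'a::euclidean_space set \<Rightarrow> bool" where
  "is_lattice L \<longleftrightarrow> (\<exists>B. independent B \<and> L = int_span B)"

definition integral_lattice :: "'a::euclidean_space set \<Rightarrow> bool" where
  "integral_lattice L \<longleftrightarrow> is_lattice L \<and> (\<forall>x\<in>L. \<forall>y\<in>L. x \<bullet> y \<in> \<int>)"

definition gram_matrix :: "('i::finite \<Rightarrow> 'a::euclidean_space) \<Rightarrow> real^'i^'i" where
  "gram_matrix e = (\<chi> i j. e i \<bullet> e j)"

text \<open>\<open>adjoin L X\<close> is the lattice usually written $L(x_1, \ldots, x_k)$, where
  $X = \{x_1, \ldots, x_k\}$.\<close>

definition adjoin :: "'a::euclidean_space set \<Rightarrow> 'a set \<Rightarrow> 'a set" where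
  "adjoin L X = int_span (L \<union> X)"

definition isometric_lattices :: "'a::euclidean_space set \<Rightarrow> 'b::euclidean_space set \<Rightarrow> bool" where
  "isometric_lattices L L' \<longleftrightarrow>
     (\<exists>\<phi>. bij_betw \<phi> L L' \<and>
          (\<forall>x\<in>L. \<forall>y\<in>L. \<phi> (x + y) = \<phi> x + \<phi> y) \<and>
          (\<forall>x\<in>L. \<forall>y\<in>L. \<phi> x \<bullet> \<phi> y = x \<bullet> y))"

text \<open>In the index type \<open>5\<close> the numeral \<open>5\<close> denotes the same element as \<open>0\<close>, so \<open>1, \<dots>, 5\<close> are
  its five distinct elements, and \<open>vector\<close> lists entries in the order of the indices
  \<open>1, \<dots>, 5\<close>.\<close>

definition gram5 :: "real^5^5" where
  "gram5 = 2 *\<^sub>R vector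
     [vector [ 2, -1,  0,  0,  0],
      vector [-1,  2, -1,  0,  0],
      vector [ 0, -1,  2, -1, -1],
      vector [ 0,  0, -1,  2,  0],
      vector [ 0,  0, -1,  0,  2]]"

lemma UNIV_5: "(UNIV :: 5 set) = {1, 2, 3, 4, 5}"
proof -
  have "card {1, 2, 3, 4, 5 :: 5} = CARD(5)" by simp
  then show ?thesis by (metis card_eq_UNIV_imp_eq_UNIV finite)
qed

lemma vector_5:
  "(vector [a, b, c, d, x] :: 'a::zero^5) $ 1 = a"
  "(vector [a, b, c, d, x] :: 'a::zero^5) $ 2 = b"
  "(vector [a, b, c, d, x] :: 'a::zero^5) $ 3 = c"
  "(vector [a, b, c, d, x] :: 'a::zero^5) $ 4 = d"
  "(vector [a, b, c, d, x] :: 'a::zero^5) $ 5 = x"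
  by (simp_all add: vector_def)

end

theory Submission
  imports Defs
begin

text \<open>\<open>\<Lambda>\<^sub>5\<close> is \<open>\<surd>2 D\<^sub>5\<close>.  In coordinates with respect to orthogonal vectors \<open>u\<^sub>i\<close> with
  \<open>u\<^sub>i \<bullet> u\<^sub>i = 1/2\<close>, it consists of the vectors \<open>2c\<close> with \<open>c\<close> integral of even coordinate sum.
  An integral overlattice lies in the dual lattice, and the half-integral classes of the dual are
  excluded because five odd squares never add up to a multiple of 8; so an overlattice has integral
  coordinates.  Reduced modulo 2 it is a self-orthogonal binary code of length 5, and up to a
  permutation of coordinates there are four of these.  For each code the lattice either contains
  the vectors \<open>2u\<^sub>k\<close> and is determined by the code, or it does not, and then sign changes of the
  \<open>u\<^sub>i\<close> bring it to a standard form.  Signed permutations of the \<open>u\<^sub>i\<close> are isometries, which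
  gives the eight classes.\<close>

section \<open>Integral spans\<close>

lemma int_span_base: "x \<in> S \<Longrightarrow> x \<in> int_span S"
  unfolding int_span_def by (rule module.span_base[OF module_int_scaleR])

lemma int_span_zero: "0 \<in> int_span S"
  unfolding int_span_def by (rule module.span_zero[OF module_int_scaleR])

lemma int_span_add: "x \<in> int_span S \<Longrightarrow> y \<in> int_span S \<Longrightarrow> x + y \<in> int_span S"
  unfolding int_span_def by (rule module.span_add[OF module_int_scaleR])

lemma int_span_diff: "x \<in> int_span S \<Longrightarrow> y \<in> int_span S \<Longrightarrow> x - y \<in> int_span S"
  unfolding int_span_def by (rule module.span_diff[OF module_int_scaleR])

lemma int_span_scale: "x \<in> int_span S \<Longrightarrow> real_of_int k *\<^sub>R x \<in> int_span S"
  unfolding int_span_def by (rule module.span_scale[OF module_int_scaleR])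

text \<open>Closure under differences together with 0 yields negatives, sums and then all integer
  multiples, so it suffices to check that \<open>M\<close> is an additive subgroup.\<close>

lemma int_span_minimal:
  assumes "S \<subseteq> M" and "0 \<in> M" and diff: "\<And>x y. x \<in> M \<Longrightarrow> y \<in> M \<Longrightarrow> x - y \<in> M"
  shows "int_span S \<subseteq> M"
proof -
  have neg: "- x \<in> M" if "x \<in> M" for x
    using diff[OF \<open>0 \<in> M\<close> that] by simp
  have add: "x + y \<in> M" if "x \<in> M" "y \<in> M" for x y
    using diff[OF that(1) neg[OF that(2)]] by simp
  have nat: "real n *\<^sub>R x \<in> M" if "x \<in> M" for x n
    by (induction n) (auto simp: \<open>0 \<in> M\<close> scaleR_left_distrib intro: add that)
  have "real_of_int k *\<^sub>R x \<in> M" if "x \<in> M" for x k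
    using nat[OF that] neg[OF nat[OF that]] by (cases k rule: int_cases2) auto
  then have "module.subspace (\<lambda>(k::int) x. real_of_int k *\<^sub>R x) M"
    using \<open>0 \<in> M\<close> add by (simp add: module.subspace_def[OF module_int_scaleR])
  then show ?thesis
    unfolding int_span_def using module.span_minimal[OF module_int_scaleR] \<open>S \<subseteq> M\<close> by blast
qed

text \<open>A real linear map is in particular a homomorphism of modules over the integers.\<close>

lemma int_span_image:
  assumes "linear f"
  shows "int_span (f ` S) = f ` int_span S"
proof -
  interpret module_hom "\<lambda>(k::int) x. real_of_int k *\<^sub>R x" "\<lambda>(k::int) x. real_of_int k *\<^sub>R x" f
    by (intro module_hom.intro module_int_scaleR module_hom_axioms.intro)
      (simp_all add: linear_add[OF assms] linear_scale[OF assms])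
  show ?thesis
    unfolding int_span_def by (rule span_image)
qed

lemma int_span_subset_span: "int_span S \<subseteq> span S"
  by (intro int_span_minimal span_superset span_zero span_diff)

section \<open>Scaled orthonormal frames\<close>

text \<open>The square 1/2 makes inner products of integer combinations halves of integers, so
  integrality becomes a parity condition on coordinates.\<close>

definition half_orthonormal :: "('i::finite \<Rightarrow> 'a::euclidean_space) \<Rightarrow> bool" where
  "half_orthonormal v \<longleftrightarrow> (\<forall>i j. v i \<bullet> v j = (if i = j then 1/2 else 0))"

definition comb :: "('i::finite \<Rightarrow> 'a::euclidean_space) \<Rightarrow> ('i \<Rightarrow> int) \<Rightarrow> 'a" where
  "comb v n = (\<Sum>i\<in>UNIV. real_of_int (n i) *\<^sub>R v i)"

lemma comb_zero: "comb v (\<lambda>i. 0) = 0"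
  by (simp add: comb_def)

lemma comb_add: "comb v (\<lambda>i. n i + m i) = comb v n + comb v m"
  by (simp add: comb_def scaleR_left_distrib sum.distrib)

lemma comb_diff: "comb v (\<lambda>i. n i - m i) = comb v n - comb v m"
  by (simp add: comb_def scaleR_left_diff_distrib sum_subtractf)

lemma comb_single: "comb v (\<lambda>i. if i = k then a else 0) = real_of_int a *\<^sub>R v k"
proof -
  have "comb v (\<lambda>i. if i = k then a else 0) = (\<Sum>i\<in>UNIV. if i = k then real_of_int a *\<^sub>R v i else 0)"
    unfolding comb_def by (rule sum.cong) auto
  then show ?thesis by simp
qed

lemma comb_inner:
  assumes "half_orthonormal v"
  shows "comb v n \<bullet> comb v m = real_of_int (\<Sum>i\<in>UNIV. n i * m i) / 2"
proof -
  have "comb v n \<bullet> comb v m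
      = (\<Sum>i\<in>UNIV. \<Sum>j\<in>UNIV. if i = j then real_of_int (n i * m j) / 2 else 0)"
    unfolding comb_def inner_sum_left inner_sum_right
    using assms by (intro sum.cong) (auto simp: half_orthonormal_def)
  then show ?thesis by (simp add: sum_divide_distrib)
qed

lemma comb_perm: "bij p \<Longrightarrow> comb (v \<circ> p) (n \<circ> p) = comb v n"
  unfolding comb_def comp_def
  using sum.reindex_bij_betw[of p UNIV UNIV "\<lambda>i. real_of_int (n i) *\<^sub>R v i"] by simp

lemma comb_flip: "comb (v(k := - v k)) n = comb v (n(k := - n k))"
  unfolding comb_def by (rule sum.cong) auto

text \<open>The root lattice \<open>D\<^sub>n\<close> scaled by \<open>\<surd>2\<close>, in the orthonormal basis \<open>\<surd>2 v\<^sub>i\<close>.\<close>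

definition scaled_D :: "('i::finite \<Rightarrow> 'a::euclidean_space) \<Rightarrow> 'a set" where
  "scaled_D v = {comb v (\<lambda>i. 2 * c i) | c. even (\<Sum>i\<in>UNIV. c i)}"

lemma scaled_D_I: "even (\<Sum>i\<in>UNIV. c i) \<Longrightarrow> comb v (\<lambda>i. 2 * c i) \<in> scaled_D v"
  by (auto simp: scaled_D_def)

text \<open>One inclusion, proved for every frame and every bijection, gives the other when applied
  to \<open>v \<circ> p\<close> and \<open>inv p\<close>.\<close>

lemma scaled_D_perm:
  fixes v :: "'i::finite \<Rightarrow> 'a::euclidean_space" and p :: "'i \<Rightarrow> 'i"
  assumes "bij p"
  shows "scaled_D (v \<circ> p) = scaled_D v"
proof -
  have sub: "scaled_D v \<subseteq> scaled_D (v \<circ> p)" if "bij p" for p and v :: "'i \<Rightarrow> 'a"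
  proof
    fix x assume "x \<in> scaled_D v"
    then obtain c where c: "x = comb v (\<lambda>i. 2 * c i)" "even (\<Sum>i\<in>UNIV. c i)"
      by (auto simp: scaled_D_def)
    have "x = comb (v \<circ> p) (\<lambda>i. 2 * (c \<circ> p) i)"
      using comb_perm[OF that, of v "\<lambda>i. 2 * c i"] c(1) by (simp add: comp_def)
    moreover have "(\<Sum>i\<in>UNIV. (c \<circ> p) i) = (\<Sum>i\<in>UNIV. c i)"
      using sum.reindex_bij_betw[of p UNIV UNIV c] that by simp
    ultimately show "x \<in> scaled_D (v \<circ> p)"
      using c(2) scaled_D_I[of "c \<circ> p" "v \<circ> p"] by simp
  qed
  have "scaled_D (v \<circ> p) \<subseteq> scaled_D ((v \<circ> p) \<circ> inv p)"
    by (rule sub[OF bij_imp_bij_inv[OF assms]])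
  also have "(v \<circ> p) \<circ> inv p = v"
    using assms by (simp add: fun_eq_iff bij_is_surj surj_f_inv_f)
  finally show ?thesis using sub[OF assms] by blast
qed

lemma even_sum_flip: "even (\<Sum>i\<in>UNIV. (c(k := - c k)) i) \<longleftrightarrow> even (\<Sum>i\<in>UNIV. c i)"
  for c :: "'i::finite \<Rightarrow> int"
proof -
  have "(\<Sum>i\<in>UNIV. (c(k := - c k)) i) = (\<Sum>i\<in>UNIV. c i - (if i = k then 2 * c k else 0))"
    by (rule sum.cong) auto
  then show ?thesis by (simp add: sum_subtractf)
qed

lemma scaled_D_flip:
  fixes v :: "'i::finite \<Rightarrow> 'a::euclidean_space"
  shows "scaled_D (v(k := - v k)) = scaled_D v"
proof -
  have sub: "scaled_D (v(k := - v k)) \<subseteq> scaled_D v" for v :: "'i \<Rightarrow> 'a"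
  proof
    fix x assume "x \<in> scaled_D (v(k := - v k))"
    then obtain c where c: "x = comb (v(k := - v k)) (\<lambda>i. 2 * c i)" "even (\<Sum>i\<in>UNIV. c i)"
      by (auto simp: scaled_D_def)
    have "x = comb v (\<lambda>i. 2 * (c(k := - c k)) i)"
      unfolding c(1) comb_flip by (rule arg_cong[where f = "comb v"]) auto
    moreover have "even (\<Sum>i\<in>UNIV. (c(k := - c k)) i)"
      using c(2) by (simp only: even_sum_flip)
    ultimately show "x \<in> scaled_D v"
      by (simp only: scaled_D_I)
  qed
  have "scaled_D v = scaled_D ((v(k := - v k))(k := - (v(k := - v k)) k))"
    by simp
  also have "\<dots> \<subseteq> scaled_D (v(k := - v k))"
    by (rule sub)
  finally show ?thesis using sub by blast
qed

section \<open>Expansion in a frame, and isometries between integral spans\<close>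

lemma half_orthonormal_expansion:
  assumes "half_orthonormal v" "x \<in> span (range v)"
  shows "x = (\<Sum>i\<in>UNIV. (2 * (x \<bullet> v i)) *\<^sub>R v i)"
proof -
  define f where "f x = (\<Sum>i\<in>UNIV. (2 * (x \<bullet> v i)) *\<^sub>R v i)" for x
  have "linear f"
    by (rule linearI)
      (simp_all add: f_def inner_add_left scaleR_left_distrib sum.distrib distrib_left
        scaleR_sum_right mult.left_commute)
  \<comment> \<open>The fixed vectors of \<open>f\<close> form a subspace, so only the frame vectors
    need checking; there the factor 2 cancels the square 1/2.\<close>
  then have "subspace {x. f x = x}"
    by (simp add: subspace_def linear_0 linear_add linear_scale)
  moreover have "f (v k) = v k" for k
  proof -
    have "f (v k) = (\<Sum>i\<in>UNIV. if i = k then v i else 0)"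
      unfolding f_def using assms(1) by (intro sum.cong) (auto simp: half_orthonormal_def)
    then show ?thesis by simp
  qed
  ultimately have "span (range v) \<subseteq> {x. f x = x}"
    by (intro span_minimal) auto
  then show ?thesis using assms(2) by (auto simp: f_def)
qed

text \<open>The linear map taking one frame to the other preserves inner products on the span of
  \<open>v\<close>. Since \<open>B\<close> is required for every such map, an application only
  computes images of generators and never meets the explicit formula.\<close>

lemma isometric_int_span_frames:
  fixes v :: "'i::finite \<Rightarrow> 'a::euclidean_space" and w :: "'i \<Rightarrow> 'b::euclidean_space"
  assumes v: "half_orthonormal v" and w: "half_orthonormal w"
    and A: "A \<subseteq> span (range v)"
    and B: "\<And>\<phi>. linear \<phi> \<Longrightarrow> (\<And>i. \<phi> (v i) = w i) \<Longrightarrow> \<phi> ` A = B"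
  shows "isometric_lattices (int_span A) (int_span B)"
proof -
  define \<phi> where "\<phi> x = (\<Sum>i\<in>UNIV. (2 * (x \<bullet> v i)) *\<^sub>R w i)" for x
  have lin: "linear \<phi>"
    by (rule linearI)
      (simp_all add: \<phi>_def inner_add_left scaleR_left_distrib sum.distrib distrib_left
        scaleR_sum_right mult.left_commute)
  have "\<phi> (v k) = (\<Sum>i\<in>UNIV. if i = k then w i else 0)" for k
    unfolding \<phi>_def using v by (intro sum.cong) (auto simp: half_orthonormal_def)
  then have \<phi>v: "\<phi> (v k) = w k" for k by simp
  have "(\<phi> x \<bullet> w j) = x \<bullet> v j" for x j
  proof -
    have "\<phi> x \<bullet> w j = (\<Sum>i\<in>UNIV. if i = j then x \<bullet> v i else 0)"
      unfolding \<phi>_def inner_sum_left using w by (intro sum.cong) (auto simp: half_orthonormal_def)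
    then show ?thesis by simp
  qed
  then have \<phi>w: "\<phi> x \<bullet> \<phi> y = (\<Sum>i\<in>UNIV. 2 * (y \<bullet> v i) * (x \<bullet> v i))" for x y
    unfolding \<phi>_def[of y] by (simp add: inner_sum_right)
  \<comment> \<open>Expanding \<open>y\<close> alone in the frame already turns
    \<open>x \<bullet> y\<close> into the sum in \<open>\<phi>w\<close>.\<close>
  have inner: "\<phi> x \<bullet> \<phi> y = x \<bullet> y" if "y \<in> span (range v)" for x y
    using arg_cong[OF half_orthonormal_expansion[OF v that], of "inner x"]
    by (simp add: \<phi>w inner_sum_right)
  have sub: "int_span A \<subseteq> span (range v)"
    using int_span_subset_span[of A] span_minimal[OF A subspace_span] by (rule subset_trans)
  have "inj_on \<phi> (int_span A)"
  proof (rule inj_onI)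
    fix x y assume xy: "x \<in> int_span A" "y \<in> int_span A" "\<phi> x = \<phi> y"
    then have "x - y \<in> span (range v)" using sub by (blast intro: span_diff)
    then have "(x - y) \<bullet> (x - y) = \<phi> (x - y) \<bullet> \<phi> (x - y)" by (simp add: inner)
    then show "x = y" using xy by (simp add: linear_diff[OF lin])
  qed
  then have "bij_betw \<phi> (int_span A) (int_span B)"
    using B[OF lin \<phi>v] by (simp add: bij_betw_def int_span_image[OF lin, symmetric])
  then show ?thesis
    unfolding isometric_lattices_def using sub inner linear_add[OF lin] by blast
qed

section \<open>Overlattices and their binary codes\<close>

text \<open>The frame is a parameter because permutations and sign changes will act on
  \<open>v\<close> while \<open>M\<close> stays fixed. Discreteness of \<open>M\<close> is expressed
  by integer coordinates instead of a basis.\<close>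

definition overlattice :: "('i::finite \<Rightarrow> 'a::euclidean_space) \<Rightarrow> 'a set \<Rightarrow> bool" where
  "overlattice v M \<longleftrightarrow> half_orthonormal v \<and> scaled_D v \<subseteq> M \<and> M \<subseteq> range (comb v) \<and>
     (\<forall>x\<in>M. \<forall>y\<in>M. x - y \<in> M) \<and> (\<forall>x\<in>M. \<forall>y\<in>M. x \<bullet> y \<in> \<int>)"

text \<open>This is the binary code of \<open>M\<close>, its coordinate vectors reduced modulo 2. A
  word is encoded by its support, so addition of words is symmetric difference.\<close>

definition odd_supports :: "('i::finite \<Rightarrow> 'a::euclidean_space) \<Rightarrow> 'a set \<Rightarrow> 'i set set" where
  "odd_supports v M = {{i. odd (n i)} | n. comb v n \<in> M}"

section \<open>Signed permutations of the frame\<close>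

lemma overlattice_perm:
  fixes v :: "'i::finite \<Rightarrow> 'a::euclidean_space" and p :: "'i \<Rightarrow> 'i"
  assumes "bij p" "overlattice v M"
  shows "overlattice (v \<circ> p) M"
proof -
  have "comb v n \<in> range (comb (v \<circ> p))" for n
    unfolding comb_perm[OF assms(1), of v n, symmetric] by (rule rangeI)
  then have "range (comb v) \<subseteq> range (comb (v \<circ> p))" by blast
  then have "M \<subseteq> range (comb (v \<circ> p))"
    using assms(2) unfolding overlattice_def by (meson subset_trans)
  moreover have "half_orthonormal (v \<circ> p)"
    using assms by (auto simp: overlattice_def half_orthonormal_def bij_is_inj inj_eq)
  ultimately show ?thesis
    using assms by (simp add: overlattice_def scaled_D_perm)
qed

lemma overlattice_flip:
  assumes "overlattice v M"
  shows "overlattice (v(k := - v k)) M"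
proof -
  have "comb v n \<in> range (comb (v(k := - v k)))" for n
    using comb_flip[of v k "n(k := - n k)"] by (simp add: range_eqI[of _ _ "n(k := - n k)"])
  then have "range (comb v) \<subseteq> range (comb (v(k := - v k)))" by blast
  then have "M \<subseteq> range (comb (v(k := - v k)))"
    using assms unfolding overlattice_def by (meson subset_trans)
  moreover have "half_orthonormal (v(k := - v k))"
    using assms by (auto simp: overlattice_def half_orthonormal_def)
  ultimately show ?thesis
    using assms by (simp add: overlattice_def scaled_D_flip)
qed

lemma odd_supports_perm:
  assumes "bij p"
  shows "odd_supports (v \<circ> p) M = (\<lambda>S. p -` S) ` odd_supports v M"
proof -
  have *: "comb (v \<circ> p) n = comb v (n \<circ> inv p)" for n
    using comb_perm[OF assms, of v "n \<circ> inv p"] assms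
    by (simp add: comp_assoc bij_is_inj)
  show ?thesis
  proof (intro set_eqI iffI)
    fix S assume "S \<in> odd_supports (v \<circ> p) M"
    then obtain n where n: "S = {i. odd (n i)}" "comb v (n \<circ> inv p) \<in> M"
      by (auto simp: odd_supports_def *)
    then have "S = p -` {i. odd ((n \<circ> inv p) i)}"
      using assms by (auto simp: bij_is_inj)
    then show "S \<in> (\<lambda>S. p -` S) ` odd_supports v M"
      using n(2) unfolding odd_supports_def by blast
  next
    fix S assume "S \<in> (\<lambda>S. p -` S) ` odd_supports v M"
    then obtain n where n: "S = p -` {i. odd (n i)}" "comb v n \<in> M"
      by (auto simp: odd_supports_def)
    then have "S = {i. odd ((n \<circ> p) i)}" "comb (v \<circ> p) (n \<circ> p) \<in> M"
      by (auto simp: comb_perm[OF assms])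
    then show "S \<in> odd_supports (v \<circ> p) M"
      unfolding odd_supports_def by blast
  qed
qed

lemma odd_supports_flip:
  fixes v :: "'i::finite \<Rightarrow> 'a::euclidean_space"
  shows "odd_supports (v(k := - v k)) M = odd_supports v M"
proof -
  have sub: "odd_supports (v(k := - v k)) M \<subseteq> odd_supports v M" for v :: "'i \<Rightarrow> 'a"
  proof
    fix S assume "S \<in> odd_supports (v(k := - v k)) M"
    then obtain n where n: "S = {i. odd (n i)}" "comb v (n(k := - n k)) \<in> M"
      by (auto simp: odd_supports_def comb_flip)
    then have "S = {i. odd ((n(k := - n k)) i)}" by auto
    then show "S \<in> odd_supports v M"
      using n(2) unfolding odd_supports_def by blast
  qed
  have "odd_supports v M = odd_supports ((v(k := - v k))(k := - (v(k := - v k)) k)) M"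
    by simp
  also have "\<dots> \<subseteq> odd_supports (v(k := - v k)) M"
    by (rule sub)
  finally show ?thesis using sub by blast
qed

section \<open>Linearity and self-orthogonality of the code\<close>

lemma overlattice_zero: "overlattice v M \<Longrightarrow> 0 \<in> M"
  unfolding overlattice_def scaled_D_def using comb_zero[of v]
  by (force intro!: exI[of _ "\<lambda>i. 0"])

lemma overlattice_diff: "overlattice v M \<Longrightarrow> x \<in> M \<Longrightarrow> y \<in> M \<Longrightarrow> x - y \<in> M"
  by (simp add: overlattice_def)

lemma overlattice_add: "overlattice v M \<Longrightarrow> x \<in> M \<Longrightarrow> y \<in> M \<Longrightarrow> x + y \<in> M"
  using overlattice_diff[of v M x "0 - y"] overlattice_diff[of v M 0 y] overlattice_zero[of v M]
  by simp

lemma odd_supports_empty: "overlattice v M \<Longrightarrow> {} \<in> odd_supports v M"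
  using overlattice_zero[of v M] comb_zero[of v]
  by (force simp: odd_supports_def intro!: exI[of _ "\<lambda>i. 0"])

lemma odd_supports_sym_diff:
  assumes "overlattice v M" "S \<in> odd_supports v M" "T \<in> odd_supports v M"
  shows "sym_diff S T \<in> odd_supports v M"
proof -
  obtain n m where nm: "S = {i. odd (n i)}" "T = {i. odd (m i)}" "comb v n \<in> M" "comb v m \<in> M"
    using assms by (auto simp: odd_supports_def)
  have "sym_diff S T = {i. odd (n i - m i)}" using nm by auto
  moreover have "comb v (\<lambda>i. n i - m i) \<in> M"
    using nm overlattice_diff[OF assms(1)] by (simp add: comb_diff)
  ultimately show ?thesis
    unfolding odd_supports_def by (intro CollectI exI[of _ "\<lambda>i. n i - m i"] conjI)
qed

text \<open>The inner product is half of the sum of the \<open>n i * m i\<close>, so integrality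
  makes this sum even; its odd terms are exactly those with index in
  \<open>S \<inter> T\<close>.\<close>

lemma odd_supports_orthogonal:
  assumes "overlattice v M" "S \<in> odd_supports v M" "T \<in> odd_supports v M"
  shows "even (card (S \<inter> T))"
proof -
  obtain n m where nm: "S = {i. odd (n i)}" "T = {i. odd (m i)}" "comb v n \<in> M" "comb v m \<in> M"
    using assms by (auto simp: odd_supports_def)
  have "comb v n \<bullet> comb v m \<in> \<int>" "half_orthonormal v"
    using nm assms(1) by (auto simp: overlattice_def)
  then obtain k where "real_of_int (\<Sum>i\<in>UNIV. n i * m i) / 2 = real_of_int k"
    by (auto simp: comb_inner elim: Ints_cases)
  then have "real_of_int (\<Sum>i\<in>UNIV. n i * m i) = real_of_int (2 * k)" by simp
  then have "(\<Sum>i\<in>UNIV. n i * m i) = 2 * k" by (rule of_int_eq_iff[THEN iffD1])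
  then have "even (card {i \<in> UNIV. odd (n i * m i)})"
    using even_sum_iff[of UNIV "\<lambda>i. n i * m i"] by simp
  moreover have "{i \<in> UNIV. odd (n i * m i)} = S \<inter> T" using nm by auto
  ultimately show ?thesis by simp
qed

text \<open>\<open>2 v\<^sub>k\<close> represents the nontrivial class of \<open>2\<int>\<^sup>n\<close> modulo \<open>2 D\<^sub>n\<close>, whatever \<open>k\<close> is.\<close>

lemma comb_even:
  "comb v (\<lambda>i. 2 * c i) \<in> scaled_D v \<or> comb v (\<lambda>i. 2 * c i) - 2 *\<^sub>R v k \<in> scaled_D v"
proof (cases "even (\<Sum>i\<in>UNIV. c i)")
  case False
  \<comment> \<open>Lowering the coefficient at \<open>k\<close> by 1 repairs the parity of the sum
    and amounts to subtracting \<open>2 *\<^sub>R v k\<close>.\<close>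
  define d where "d i = c i - (if i = k then 1 else 0)" for i
  have "comb v (\<lambda>i. 2 * d i) = comb v (\<lambda>i. 2 * c i) - comb v (\<lambda>i. if i = k then 2 else 0)"
    unfolding comb_diff[symmetric] by (rule arg_cong[where f = "comb v"]) (auto simp: d_def)
  then have "comb v (\<lambda>i. 2 * d i) = comb v (\<lambda>i. 2 * c i) - 2 *\<^sub>R v k"
    by (simp add: comb_single)
  moreover have "even (\<Sum>i\<in>UNIV. d i)"
    using False by (simp add: d_def sum_subtractf)
  ultimately show ?thesis using scaled_D_I[of d v] by simp
qed (simp add: scaled_D_I)

section \<open>Vectors with a given odd support, and integrality of coordinates\<close>

lemma same_parity_diff:
  assumes "{i. odd (n i)} = {i. odd (m i)}"
  obtains c where "comb v n - comb v m = comb v (\<lambda>i. 2 * c i)" "\<And>i. 2 * c i = n i - m i"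
proof
  define c where "c i = (n i - m i) div 2" for i
  have "even (n i - m i)" for i using assms by (auto simp: set_eq_iff)
  then show "2 * c i = n i - m i" for i by (simp add: c_def)
  then show "comb v n - comb v m = comb v (\<lambda>i. 2 * c i)" by (simp add: comb_diff)
qed

text \<open>An odd support determines its vectors modulo \<open>2\<int>\<^sup>n\<close>, and changing one sign at an odd
  coordinate changes the class modulo \<open>2 D\<^sub>n\<close>.\<close>

lemma overlattice_adjust_sign:
  assumes "overlattice v M" "{i. odd (g i)} \<in> odd_supports v M" "odd (g k)"
  obtains w where "w = v \<or> w = v(k := - v k)" "overlattice w M"
    "odd_supports w M = odd_supports v M" "comb w g \<in> M"
proof -
  obtain n where n: "{i. odd (n i)} = {i. odd (g i)}" "comb v n \<in> M"
    using assms(2) unfolding odd_supports_def by auto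
  obtain c where c: "comb v n - comb v g = comb v (\<lambda>i. 2 * c i)"
    using same_parity_diff[OF n(1)] by blast
  show ?thesis
  proof (cases "even (\<Sum>i\<in>UNIV. c i)")
    case True
    then have "comb v n - comb v g \<in> M"
      using assms(1) c scaled_D_I[of c v] by (auto simp: overlattice_def)
    then have "comb v n - (comb v n - comb v g) \<in> M"
      using overlattice_diff[OF assms(1) n(2)] by blast
    then show ?thesis using that[of v] assms(1) by simp
  next
    case False
    \<comment> \<open>Replacing \<open>g k\<close> by \<open>- g k\<close> changes half the
      difference from \<open>n\<close> by \<open>g k\<close> at the place \<open>k\<close>. As
      \<open>g k\<close> is odd, the odd sum of \<open>c\<close> becomes even.\<close>
    define d where "d i = c i + (if i = k then g k else 0)" for i
    have "even (\<Sum>i\<in>UNIV. d i)"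
      using False assms(3) by (simp add: d_def sum.distrib)
    then have "comb v (\<lambda>i. 2 * d i) \<in> M"
      using assms(1) scaled_D_I[of d v] by (auto simp: overlattice_def)
    then have "comb v n - comb v (\<lambda>i. 2 * d i) \<in> M"
      using overlattice_diff[OF assms(1) n(2)] by blast
    moreover have "comb v (\<lambda>i. 2 * d i) = comb v (\<lambda>i. 2 * c i) + comb v (\<lambda>i. if i = k then 2 * g k else 0)"
      unfolding comb_add[symmetric] by (rule arg_cong[where f = "comb v"]) (auto simp: d_def)
    ultimately have "comb v g - comb v (\<lambda>i. if i = k then 2 * g k else 0) \<in> M"
      by (simp add: c[symmetric])
    also have "comb v g - comb v (\<lambda>i. if i = k then 2 * g k else 0) = comb v (g(k := - g k))"
      unfolding comb_diff[symmetric] by (rule arg_cong[where f = "comb v"]) auto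
    finally show ?thesis
      using that[of "v(k := - v k)"] overlattice_flip[OF assms(1)] odd_supports_flip[of v k M]
      by (simp add: comb_flip)
  qed
qed

text \<open>An element of \<open>M\<close> and a representative of its code word differ by a vector
  with even coordinates, which lies in \<open>scaled_D v\<close> or in its translate by
  \<open>2 *\<^sub>R v k\<close>. The second case forces \<open>2 *\<^sub>R v k\<close> into
  \<open>M\<close>. So \<open>M\<close> is determined by one representative per word and by whether
  it contains \<open>2 *\<^sub>R v k\<close>.\<close>

lemma overlattice_eq_int_span:
  assumes M: "overlattice v M" and X: "X \<subseteq> M"
    and code: "\<And>S. S \<in> odd_supports v M \<Longrightarrow>
      \<exists>g. {i. odd (g i)} = S \<and> comb v g \<in> int_span (scaled_D v \<union> X)"
    and double: "2 *\<^sub>R v k \<in> M \<Longrightarrow> 2 *\<^sub>R v k \<in> int_span (scaled_D v \<union> X)"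
  shows "M = int_span (scaled_D v \<union> X)"
proof
  show sub: "int_span (scaled_D v \<union> X) \<subseteq> M"
    using M X by (intro int_span_minimal overlattice_zero[OF M]) (auto simp: overlattice_def)
  show "M \<subseteq> int_span (scaled_D v \<union> X)"
  proof
    fix x assume x: "x \<in> M"
    then obtain n where n: "x = comb v n" using M by (auto simp: overlattice_def)
    then have "{i. odd (n i)} \<in> odd_supports v M" using x by (auto simp: odd_supports_def)
    then obtain g where g: "{i. odd (g i)} = {i. odd (n i)}"
      "comb v g \<in> int_span (scaled_D v \<union> X)"
      using code by blast
    obtain c where c: "x - comb v g = comb v (\<lambda>i. 2 * c i)"
      using same_parity_diff[OF g(1)[symmetric]] n by blast
    have D: "scaled_D v \<subseteq> int_span (scaled_D v \<union> X)" by (auto intro: int_span_base)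
    have xg: "x - comb v g \<in> M" using overlattice_diff[OF M x] g(2) sub by blast
    have "x - comb v g \<in> int_span (scaled_D v \<union> X)"
    proof (cases "x - comb v g \<in> scaled_D v")
      case False
      then have e: "x - comb v g - 2 *\<^sub>R v k \<in> scaled_D v"
        using comb_even[of v c k] c by simp
      then have "x - comb v g - 2 *\<^sub>R v k \<in> M" using M by (auto simp: overlattice_def)
      then have "2 *\<^sub>R v k \<in> M" using overlattice_diff[OF M xg] by force
      then show ?thesis using int_span_add[OF _ double] e D by force
    qed (use D in blast)
    then show "x \<in> int_span (scaled_D v \<union> X)" using int_span_add[OF _ g(2)] by force
  qed
qed

text \<open>Integral pairing with \<open>scaled_D v\<close> makes the coordinates \<open>a i\<close>
  either all integers or all halves of odd integers. In the second case \<open>x \<bullet> x\<close>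
  is one eighth of a sum of odd squares, each congruent to 1 modulo 8, so 8 would divide the
  rank.\<close>

lemma integral_coordinates:
  fixes v :: "'i::finite \<Rightarrow> 'a::euclidean_space"
  assumes v: "half_orthonormal v" and x: "x \<in> span (range v)"
    and D: "\<And>y. y \<in> scaled_D v \<Longrightarrow> x \<bullet> y \<in> \<int>" and norm: "x \<bullet> x \<in> \<int>"
    and card: "\<not> 8 dvd CARD('i)"
  shows "x \<in> range (comb v)"
proof -
  define a where "a i = 2 * (x \<bullet> v i)" for i
  have exp: "x = (\<Sum>i\<in>UNIV. a i *\<^sub>R v i)"
    unfolding a_def by (rule half_orthonormal_expansion[OF v x])
  have int: "(\<Sum>i\<in>UNIV. real_of_int (c i) * a i) \<in> \<int>" if "even (\<Sum>i\<in>UNIV. c i)" for c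
  proof -
    have "x \<bullet> comb v (\<lambda>i. 2 * c i) = (\<Sum>i\<in>UNIV. real_of_int (c i) * a i)"
      by (simp add: comb_def inner_sum_right a_def mult_ac)
    then show ?thesis using D[OF scaled_D_I[OF that]] by simp
  qed
  \<comment> \<open>This is the pairing of \<open>x\<close> with \<open>4 *\<^sub>R v i\<close>,
    whose coefficient sum 2 is even.\<close>
  have "2 * a i \<in> \<int>" for i
  proof -
    have "(\<Sum>j\<in>UNIV. real_of_int (if j = i then 2 else 0) * a j) = (\<Sum>j\<in>UNIV. if j = i then 2 * a j else 0)"
      by (rule sum.cong) auto
    then show ?thesis using int[of "\<lambda>j. if j = i then 2 else 0"] by simp
  qed
  then have "\<forall>i. \<exists>b. 2 * a i = real_of_int b" by (metis Ints_cases)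
  then obtain b where b: "\<And>i. 2 * a i = real_of_int (b i)" by metis
  have parity: "even (b i - b j)" for i j
  proof -
    \<comment> \<open>Pairing with twice \<open>v i - v j\<close> shows that any two coordinates
      differ by an integer.\<close>
    let ?c = "\<lambda>l. (if l = i then 1 else 0) - (if l = j then 1 else 0) :: int"
    have "(\<Sum>l\<in>UNIV. real_of_int (?c l) * a l)
        = (\<Sum>l\<in>UNIV. (if l = i then a l else 0) - (if l = j then a l else 0))"
      by (rule sum.cong) auto
    then have "a i - a j \<in> \<int>"
      using int[of ?c] by (simp add: sum_subtractf)
    then obtain k where "a i - a j = real_of_int k" by (auto elim: Ints_cases)
    then have "real_of_int (b i - b j) = real_of_int (2 * k)"
      using b[of i] b[of j] by simp
    then have "b i - b j = 2 * k" by (rule of_int_eq_iff[THEN iffD1])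
    then show ?thesis by simp
  qed
  have "x \<bullet> x = (\<Sum>i\<in>UNIV. a i * (x \<bullet> v i))"
    using arg_cong[OF exp, of "inner x"] by (simp add: inner_sum_right)
  also have "\<dots> = (\<Sum>i\<in>UNIV. real_of_int ((b i)\<^sup>2) / 8)"
    by (rule sum.cong) (simp_all add: b[symmetric] a_def power2_eq_square)
  finally have "x \<bullet> x = real_of_int (\<Sum>i\<in>UNIV. (b i)\<^sup>2) / 8"
    by (simp add: sum_divide_distrib)
  moreover obtain k where "x \<bullet> x = real_of_int k"
    using norm by (rule Ints_cases)
  ultimately have "real_of_int (\<Sum>i\<in>UNIV. (b i)\<^sup>2) = real_of_int (8 * k)" by simp
  then have sq: "(\<Sum>i\<in>UNIV. (b i)\<^sup>2) = 8 * k" by (rule of_int_eq_iff[THEN iffD1])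
  have "\<not> (\<forall>i. odd (b i))"
  proof
    assume odd: "\<forall>i. odd (b i)"
    have "8 dvd (b i)\<^sup>2 - 1" for i
    proof -
      obtain t where t: "b i = 2 * t + 1" using odd by (metis oddE)
      have "even (t * (t + 1))" by simp
      then obtain s where "t * (t + 1) = 2 * s" by (rule evenE)
      then have "(b i)\<^sup>2 - 1 = 8 * s"
        by (simp add: t power2_eq_square algebra_simps)
      then show ?thesis by simp
    qed
    then have "8 dvd (\<Sum>i\<in>UNIV. (b i)\<^sup>2 - 1)" by (intro dvd_sum) blast
    then have "8 dvd 8 * k - int CARD('i)" by (simp add: sum_subtractf sq)
    then have "8 dvd int CARD('i)" by presburger
    then have "int 8 dvd int CARD('i)" by simp
    then show False using card by (simp only: int_dvd_int_iff)
  qed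
  then obtain j where "even (b j)" by blast
  then have "even (b i)" for i using parity[of i j] by simp
  then have "a i = real_of_int (b i div 2)" for i
    using b[of i] by (metis dvd_mult_div_cancel mult_cancel_left of_int_mult of_int_numeral
        zero_neq_numeral)
  then have "x = comb v (\<lambda>i. b i div 2)" by (subst exp) (simp add: comb_def)
  then show ?thesis by blast
qed

section \<open>Codes and overlattices in rank five\<close>

lemma sum_5: "sum f (UNIV :: 5 set) = f 1 + f 2 + f 3 + f 4 + f 5"
  unfolding UNIV_5 by (simp add: add.assoc)

lemma forall_5: "(\<forall>i::5. P i) \<longleftrightarrow> P 1 \<and> P 2 \<and> P 3 \<and> P 4 \<and> P 5"
  by (metis UNIV_5 UNIV_I insertE emptyE)

text \<open>Lets a code be described by naming its coordinates one at a time and afterwards be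
  transported to the standard positions.\<close>

lemma exists_bij_5:
  fixes a b c d x :: 5
  assumes "distinct [a, b, c, d, x]"
  obtains p :: "5 \<Rightarrow> 5" where "bij p" "p 1 = a" "p 2 = b" "p 3 = c" "p 4 = d" "p 5 = x"
    "UNIV = {a, b, c, d, x}"
proof -
  define p :: "5 \<Rightarrow> 5" where "p = ($) (vector [a, b, c, d, x])"
  have p: "p 1 = a" "p 2 = b" "p 3 = c" "p 4 = d" "p 5 = x"
    by (simp_all add: p_def vector_5)
  have "\<forall>i j. p i = p j \<longrightarrow> i = j"
    using assms unfolding forall_5 p by auto
  then have "inj p" by (simp add: inj_def)
  then have "bij p" by (simp add: bij_def finite_UNIV_inj_surj)
  moreover have "UNIV = p ` UNIV" using \<open>bij p\<close> by (simp add: bij_is_surj)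
  then have "UNIV = {a, b, c, d, x}"
    by (simp add: UNIV_5 p)
  ultimately show thesis using p that by blast
qed

section \<open>Self-orthogonal binary codes of length five\<close>

lemma even_card_Int_pair: "a \<noteq> b \<Longrightarrow> even (card (S \<inter> {a, b})) \<longleftrightarrow> (a \<in> S \<longleftrightarrow> b \<in> S)"
  by (cases "a \<in> S"; cases "b \<in> S") auto

text \<open>Nonzero words have weight 2 or 4. If \<open>{a, b}\<close> is a word, orthogonality
  makes every word contain both or neither of \<open>a\<close> and \<open>b\<close>, and the other
  three coordinates leave room for at most one further pair. Without words of weight 2, two distinct
  words of weight 4 would add up to one, so at most one nonzero word exists.\<close>

lemma self_orthogonal_code_5:
  fixes C :: "5 set set"
  assumes zero: "{} \<in> C"
    and add: "\<And>S T. S \<in> C \<Longrightarrow> T \<in> C \<Longrightarrow> sym_diff S T \<in> C"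
    and orth: "\<And>S T. S \<in> C \<Longrightarrow> T \<in> C \<Longrightarrow> even (card (S \<inter> T))"
  obtains p :: "5 \<Rightarrow> 5" where "bij p" "C \<in> {{{}}, {{}, {p 1, p 2}}, {{}, {p 1, p 2, p 3, p 4}},
    {{}, {p 1, p 2}, {p 3, p 4}, {p 1, p 2, p 3, p 4}}}"
proof -
  have even: "even (card S)" if "S \<in> C" for S
    using orth[OF that that] by simp
  have C5: "card S \<le> 5" for S :: "5 set"
    using card_mono[of UNIV S] by simp
  have nontrivial: "C = {{}} \<or> (\<exists>S\<in>C. S \<noteq> {})" using zero by blast
  consider (pair) a b where "a \<noteq> b" "{a, b} \<in> C" | (trivial) "C = {{}}"
    | (quad) S where "S \<in> C" "S \<noteq> {}" "\<forall>a b. a \<noteq> b \<longrightarrow> {a, b} \<notin> C"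
    using nontrivial by metis
  then show thesis
  proof cases
    case pair
    have pairC: "a \<in> S \<longleftrightarrow> b \<in> S" if "S \<in> C" for S
      using orth[OF that pair(2)] even_card_Int_pair[OF pair(1)] by blast
    show thesis
    proof (cases "C = {{}, {a, b}}")
      case True
      have "card (UNIV - {a, b}) = 3"
        using pair(1) by (simp add: card_Diff_subset)
      then obtain c d x where "UNIV - {a, b} = {c, d, x}" "distinct [c, d, x]"
        by (auto simp: card_3_iff)
      then have "distinct [a, b, c, d, x]" using pair(1) by auto
      then obtain p :: "5 \<Rightarrow> 5" where p: "bij p" "p 1 = a" "p 2 = b" by (rule exists_bij_5)
      show thesis by (rule that[OF p(1)]) (simp add: p True)
    next
      case False
      then obtain T where T: "T \<in> C" "T \<noteq> {}" "T \<noteq> {a, b}"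
        using zero pair(2) by blast
      \<comment> \<open>Adding \<open>{a, b}\<close> if necessary moves the word off
        \<open>a\<close> and \<open>b\<close>; evenness among the remaining three coordinates then
        makes it a pair.\<close>
      define U where "U = (if a \<in> T then sym_diff T {a, b} else T)"
      have U: "U \<in> C" using add[OF T(1) pair(2)] T(1) unfolding U_def
        by (cases "a \<in> T") (simp_all only: if_True if_False)
      have U': "U \<subseteq> UNIV - {a, b}" "U \<noteq> {}"
        using pairC[OF T(1)] T by (auto simp: U_def)
      have "card U \<le> 3"
        using card_mono[OF _ U'(1)] pair(1) by (simp add: card_Diff_subset)
      moreover have "card U \<noteq> 0" using U' by simp
      ultimately have "card U = 2" using even[OF U] by presburger
      then obtain c d where cd: "U = {c, d}" "c \<noteq> d" by (auto simp: card_2_iff)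
      have dist: "distinct [a, b, c, d]" using cd U' pair(1) by auto
      then have "card (UNIV - {a, b, c, d}) = 1"
        by (simp add: card_Diff_subset)
      then obtain x where "UNIV - {a, b, c, d} = {x}" by (auto simp: card_1_singleton_iff)
      then have "distinct [a, b, c, d, x]" using dist by auto
      then obtain p :: "5 \<Rightarrow> 5" where p: "bij p" "p 1 = a" "p 2 = b" "p 3 = c" "p 4 = d"
        "UNIV = {a, b, c, d, x}" by (rule exists_bij_5)
      have "S \<in> {{}, {a, b}, {c, d}, {a, b, c, d}}" if S: "S \<in> C" for S
      proof -
        have ab: "a \<in> S \<longleftrightarrow> b \<in> S" by (rule pairC[OF S])
        have cd': "c \<in> S \<longleftrightarrow> d \<in> S"
          using orth[OF S U] even_card_Int_pair[OF cd(2)] cd(1) by blast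
        \<comment> \<open>\<open>S\<close> is a union of the blocks \<open>{a, b}\<close>,
          \<open>{c, d}\<close> and \<open>{x}\<close>, and its even weight excludes the block of
          size one.\<close>
        have eq: "S = (if a \<in> S then {a, b} else {}) \<union> (if c \<in> S then {c, d} else {})
          \<union> (if x \<in> S then {x} else {})" (is "S = ?S")
          using ab cd' p(6) by auto
        have "x \<notin> S"
        proof
          assume "x \<in> S"
          moreover have "even (card ?S)" using even[OF S] arg_cong[OF eq, of card] by argo
          ultimately show False
            using \<open>distinct [a, b, c, d, x]\<close> by (auto split: if_splits)
        qed
        then show ?thesis by (subst eq) auto
      qed
      moreover have "sym_diff {a, b} {c, d} = {a, b, c, d}"
        using dist by auto
      then have "{{}, {a, b}, {c, d}, {a, b, c, d}} \<subseteq> C"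
        using zero pair(2) U cd(1) add[OF pair(2) U] by auto
      ultimately have C: "C = {{}, {a, b}, {c, d}, {a, b, c, d}}" by blast
      show thesis by (rule that[OF p(1)]) (simp add: p(2-5) C)
    qed
  next
    case trivial
    then show thesis using that[of id] by simp
  next
    case quad
    have miss: "\<exists>x. T = UNIV - {x}" if "T \<in> C" "T \<noteq> {}" for T
    proof -
      have "card T \<noteq> 2" using quad(3) that(1) by (auto simp: card_2_iff)
      moreover have "card T \<noteq> 0" using that by simp
      ultimately have "card T = 4" using even[OF that(1)] C5[of T] by presburger
      then have "card (UNIV - T) = 1" by (simp add: card_Diff_subset)
      then obtain x where "UNIV - T = {x}" by (auto simp: card_1_singleton_iff)
      then show ?thesis by blast
    qed
    obtain x where x: "S = UNIV - {x}" using miss quad by blast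
    have "T = S" if T: "T \<in> C" "T \<noteq> {}" for T
    proof -
      obtain y where y: "T = UNIV - {y}" using miss[OF T] by blast
      \<comment> \<open>The complements of two different points add up to the pair of these points,
        a word of weight 2.\<close>
      have "sym_diff S T = {x, y}" if "x \<noteq> y" using x y that by auto
      then have "x = y" using quad(3) add[OF quad(1) T(1)] by metis
      then show ?thesis using x y by simp
    qed
    then have C: "C = {{}, S}" using zero quad(1) by blast
    have "card S = Suc 3"
      using x by (simp add: card_Diff_subset)
    then obtain a B where "S = insert a B" "a \<notin> B" "card B = 3"
      unfolding card_Suc_eq by blast
    then obtain b c d where S: "S = {a, b, c, d}" "distinct [a, b, c, d]"
      by (auto simp: card_3_iff)
    then have "distinct [a, b, c, d, x]" using x by auto
    then obtain p :: "5 \<Rightarrow> 5" where p: "bij p" "p 1 = a" "p 2 = b" "p 3 = c" "p 4 = d"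
      by (rule exists_bij_5)
    show thesis by (rule that[OF p(1)]) (simp add: p C S(1))
  qed
qed

text \<open>A permutation brings the code to one of four standard forms, and sign changes put the
  chosen representatives of its generators into \<open>M\<close>. Whether \<open>M\<close> contains
  twice a frame vector then splits each of the four cases in two.\<close>

lemma overlattice_5_normal_form:
  fixes v :: "5 \<Rightarrow> 'a::euclidean_space"
  assumes "overlattice v M"
  obtains w :: "5 \<Rightarrow> 'a" and X where "half_orthonormal w" "M = int_span (scaled_D w \<union> X)"
    "X \<in> {{}, {w 1 - w 2}, {w 1 - w 2 + w 3 - w 4}, {2 *\<^sub>R w 4}, {w 1 - w 2, w 3 - w 4},
      {w 1 - w 2, w 1 + w 2}, {w 1 - w 2 + w 3 - w 4, 2 *\<^sub>R w 4},
      {w 1 - w 2, w 3 - w 4, w 1 + w 2}}"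
proof -
  \<comment> \<open>\<open>rep\<close> is the requirement on a single code word in
    \<open>overlattice_eq_int_span\<close>.\<close>
  define rep where
    "rep w Y S \<longleftrightarrow> (\<exists>g. {i. odd (g i)} = S \<and> comb w g \<in> int_span Y)"
    for w :: "5 \<Rightarrow> 'a" and Y S
  \<comment> \<open>The alternating signs are chosen so that these combinations are the halves of
    \<open>e 1\<close>, \<open>e 3\<close> and \<open>e 1 + e 3\<close> once the frame is that of
    \<open>\<Lambda>\<^sub>5\<close>.\<close>
  define g12 g34 g1234 :: "5 \<Rightarrow> int"
    where "g12 = ($) (vector [1, -1, 0, 0, 0])" and "g34 = ($) (vector [0, 0, 1, -1, 0])"
      and "g1234 = ($) (vector [1, -1, 1, -1, 0])"
  have supp: "{i. odd (g12 i)} = {1, 2}" "{i. odd (g34 i)} = {3, 4}"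
    "{i. odd (g1234 i)} = {1, 2, 3, 4}"
    unfolding set_eq_iff forall_5 g12_def g34_def g1234_def by (simp_all add: vector_5)
  have comb: "comb w g12 = w 1 - w 2" "comb w g34 = w 3 - w 4"
    "comb w g1234 = w 1 - w 2 + w 3 - w 4" for w :: "5 \<Rightarrow> 'a"
    by (simp_all add: comb_def sum_5 g12_def g34_def g1234_def vector_5)
  have odd: "odd (g12 2)" "odd (g34 4)" "odd (g1234 4)"
    by (simp_all add: g12_def g34_def g1234_def vector_5)
  have rep0: "rep w Y {}" for w Y
    unfolding rep_def by (intro exI[of _ "\<lambda>i. 0"]) (simp add: comb_zero int_span_zero)
  have rep: "w 1 - w 2 \<in> int_span Y \<Longrightarrow> rep w Y {1, 2}"
    "w 3 - w 4 \<in> int_span Y \<Longrightarrow> rep w Y {3, 4}"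
    "w 1 - w 2 + w 3 - w 4 \<in> int_span Y \<Longrightarrow> rep w Y {1, 2, 3, 4}" for w Y
    unfolding rep_def using supp comb by metis+
  have span_eq: "M = int_span (scaled_D w \<union> X)"
    if "overlattice w M" "X \<subseteq> M" "\<And>S. S \<in> odd_supports w M \<Longrightarrow> rep w (scaled_D w \<union> X) S"
      "2 *\<^sub>R w k \<in> M \<Longrightarrow> 2 *\<^sub>R w k \<in> int_span (scaled_D w \<union> X)" for w X k
    using overlattice_eq_int_span[OF that(1,2) _ that(4)] that(3) unfolding rep_def by blast
  have half: "half_orthonormal w" if "overlattice w M" for w :: "5 \<Rightarrow> 'a"
    using that by (simp add: overlattice_def)
  have double: "2 *\<^sub>R w 2 \<in> int_span (scaled_D w \<union> {w 1 - w 2, w 1 + w 2} \<union> Y)" (is "_ \<in> int_span ?Y")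
    for Y and w :: "5 \<Rightarrow> 'a"
  proof -
    have "(w 1 + w 2) - (w 1 - w 2) \<in> int_span ?Y"
      by (intro int_span_diff int_span_base) auto
    then show ?thesis by (simp add: scaleR_2)
  qed

  obtain p :: "5 \<Rightarrow> 5" where p: "bij p" "odd_supports v M \<in> {{{}}, {{}, {p 1, p 2}},
      {{}, {p 1, p 2, p 3, p 4}}, {{}, {p 1, p 2}, {p 3, p 4}, {p 1, p 2, p 3, p 4}}}"
    using self_orthogonal_code_5[of "odd_supports v M"] odd_supports_empty[OF assms]
      odd_supports_sym_diff[OF assms] odd_supports_orthogonal[OF assms] by metis
  define u where "u = v \<circ> p"
  have u: "overlattice u M" unfolding u_def by (rule overlattice_perm[OF p(1) assms])
  have vimage: "p -` {p 1, p 2} = {1, 2}" "p -` {p 3, p 4} = {3, 4}"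
    "p -` {p 1, p 2, p 3, p 4} = {1, 2, 3, 4}"
    using p(1) by (auto simp: bij_is_inj inj_eq)
  have "odd_supports u M \<in> {{{}}, {{}, {1, 2}}, {{}, {1, 2, 3, 4}},
      {{}, {1, 2}, {3, 4}, {1, 2, 3, 4}}}"
    using p(2) unfolding u_def odd_supports_perm[OF p(1)]
    by (elim insertE emptyE) (simp_all add: vimage del: vimage_insert)
  then consider (zero) "odd_supports u M = {{}}" | (pair) "odd_supports u M = {{}, {1, 2}}"
    | (quad) "odd_supports u M = {{}, {1, 2, 3, 4}}"
    | (pairs) "odd_supports u M = {{}, {1, 2}, {3, 4}, {1, 2, 3, 4}}"
    unfolding insert_iff empty_iff by argo
  then show thesis
  proof cases
    case zero
    show thesis
    proof (cases "2 *\<^sub>R u 4 \<in> M")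
      case True
      have "M = int_span (scaled_D u \<union> {2 *\<^sub>R u 4})"
        using True zero by - (rule span_eq[OF u, of _ 4], auto simp: rep0 int_span_base)
      then show thesis by (rule that[OF half[OF u]]) simp
    next
      case False
      \<comment> \<open>The condition of \<open>span_eq\<close> on the doubled frame vector is
        vacuous here, and likewise in the other negative cases below.\<close>
      have "M = int_span (scaled_D u \<union> {})"
        using False zero by - (rule span_eq[OF u, of _ 4], auto simp: rep0)
      then show thesis by (rule that[OF half[OF u]]) simp
    qed
  next
    case pair
    have "{i. odd (g12 i)} \<in> odd_supports u M" by (simp add: supp pair)
    then obtain w where "overlattice w M" "odd_supports w M = odd_supports u M" "comb w g12 \<in> M"
      by (rule overlattice_adjust_sign[where g = g12 and k = 2, OF u _ odd(1)])
    then have w: "overlattice w M" "odd_supports w M = {{}, {1, 2}}" "w 1 - w 2 \<in> M"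
      by (simp_all add: pair comb)
    show thesis
    proof (cases "2 *\<^sub>R w 2 \<in> M")
      case True
      \<comment> \<open>Next to \<open>w 1 - w 2\<close>, the generator \<open>w 1 + w 2\<close> can
        replace \<open>2 *\<^sub>R w 2\<close>; it is the one that corresponds to
        \<open>f\<^sub>1\<close>.\<close>
      have "w 1 - w 2 + 2 *\<^sub>R w 2 \<in> M" by (rule overlattice_add[OF w(1,3) True])
      then have "w 1 + w 2 \<in> M" by (simp add: scaleR_2)
      then have "M = int_span (scaled_D w \<union> {w 1 - w 2, w 1 + w 2})"
        using w double[of w "{}"]
        by - (rule span_eq[OF w(1), of _ 2], auto simp: rep0 intro: rep int_span_base)
      then show thesis by (rule that[OF half[OF w(1)]]) simp
    next
      case False
      have "M = int_span (scaled_D w \<union> {w 1 - w 2})"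
        using False w by - (rule span_eq[OF w(1), of _ 2], auto simp: rep0 intro: rep int_span_base)
      then show thesis by (rule that[OF half[OF w(1)]]) simp
    qed
  next
    case quad
    have "{i. odd (g1234 i)} \<in> odd_supports u M" by (simp add: supp quad)
    then obtain w where "overlattice w M" "odd_supports w M = odd_supports u M" "comb w g1234 \<in> M"
      by (rule overlattice_adjust_sign[where g = g1234 and k = 4, OF u _ odd(3)])
    then have w: "overlattice w M" "odd_supports w M = {{}, {1, 2, 3, 4}}"
      "w 1 - w 2 + w 3 - w 4 \<in> M"
      by (simp_all add: quad comb)
    show thesis
    proof (cases "2 *\<^sub>R w 4 \<in> M")
      case True
      have "M = int_span (scaled_D w \<union> {w 1 - w 2 + w 3 - w 4, 2 *\<^sub>R w 4})"
        using w True by - (rule span_eq[OF w(1), of _ 4], auto simp: rep0 intro: rep int_span_base)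
      then show thesis by (rule that[OF half[OF w(1)]]) simp
    next
      case False
      have "M = int_span (scaled_D w \<union> {w 1 - w 2 + w 3 - w 4})"
        using w False by - (rule span_eq[OF w(1), of _ 4], auto simp: rep0 intro: rep int_span_base)
      then show thesis by (rule that[OF half[OF w(1)]]) simp
    qed
  next
    case pairs
    have "{i. odd (g12 i)} \<in> odd_supports u M" by (simp add: supp pairs)
    then obtain u' where u': "overlattice u' M" "odd_supports u' M = odd_supports u M"
      "comb u' g12 \<in> M"
      by (rule overlattice_adjust_sign[where g = g12 and k = 2, OF u _ odd(1)])
    \<comment> \<open>The second sign change happens at coordinate 4, so it does not disturb the
      difference of the first two frame vectors already placed in \<open>M\<close>.\<close>
    have "{i. odd (g34 i)} \<in> odd_supports u' M" by (simp add: supp pairs u'(2))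
    then obtain w where w': "w = u' \<or> w = u'(4 := - u' 4)" "overlattice w M"
      "odd_supports w M = odd_supports u' M" "comb w g34 \<in> M"
      by (rule overlattice_adjust_sign[where g = g34 and k = 4, OF u'(1) _ odd(2)])
    then have w: "overlattice w M" "odd_supports w M = {{}, {1, 2}, {3, 4}, {1, 2, 3, 4}}"
      "w 3 - w 4 \<in> M"
      by (simp_all add: pairs comb u'(2))
    have w12: "w 1 - w 2 \<in> M" using w'(1) u'(3) by (auto simp: comb)
    have rep4: "rep w Y {1, 2, 3, 4}" if "w 1 - w 2 \<in> int_span Y" "w 3 - w 4 \<in> int_span Y" for Y
      using rep(3)[of w Y] int_span_add[OF that] by (simp add: add_diff_eq)
    show thesis
    proof (cases "2 *\<^sub>R w 2 \<in> M")
      case True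
      have "w 1 - w 2 + 2 *\<^sub>R w 2 \<in> M" by (rule overlattice_add[OF w(1) w12 True])
      then have "w 1 + w 2 \<in> M" by (simp add: scaleR_2)
      then have "M = int_span (scaled_D w \<union> {w 1 - w 2, w 3 - w 4, w 1 + w 2})"
        using w w12 double[of w "{w 3 - w 4}"]
        by - (rule span_eq[OF w(1), of _ 2], auto simp: rep0 insert_commute intro: rep(1,2) rep4 int_span_base)
      then show thesis by (rule that[OF half[OF w(1)]]) simp
    next
      case False
      have "M = int_span (scaled_D w \<union> {w 1 - w 2, w 3 - w 4})"
        using w w12 False
        by - (rule span_eq[OF w(1), of _ 2], auto simp: rep0 intro: rep(1,2) rep4 int_span_base)
      then show thesis by (rule that[OF half[OF w(1)]]) simp
    qed
  qed
qed

section \<open>The lattice of the theorem as a scaled root lattice, and the eight classes\<close>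

lemma scaled_D_5_basis:
  fixes u e :: "5 \<Rightarrow> 'a::euclidean_space"
  assumes e: "e 1 = 2 *\<^sub>R (u 1 - u 2)" "e 2 = 2 *\<^sub>R (u 2 - u 3)" "e 3 = 2 *\<^sub>R (u 3 - u 4)"
    "e 4 = 2 *\<^sub>R (u 4 - u 5)" "e 5 = 2 *\<^sub>R (u 4 + u 5)"
  shows "int_span (range e) = scaled_D u"
proof
  have D: "2 *\<^sub>R (\<Sum>i\<in>UNIV. real_of_int (c $ i) *\<^sub>R u i) \<in> scaled_D u"
    if "even (\<Sum>i\<in>UNIV. c $ i)" for c :: "int^5"
    using scaled_D_I[OF that, of u] by (simp add: comb_def scaleR_sum_right)
  have "\<forall>i. e i \<in> scaled_D u"
    unfolding forall_5 e
    using D[of "vector [1, -1, 0, 0, 0]"] D[of "vector [0, 1, -1, 0, 0]"]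
      D[of "vector [0, 0, 1, -1, 0]"] D[of "vector [0, 0, 0, 1, -1]"]
      D[of "vector [0, 0, 0, 1, 1]"]
    by (simp add: sum_5 vector_5)
  moreover have "x - y \<in> scaled_D u" if xy: "x \<in> scaled_D u" "y \<in> scaled_D u" for x y
  proof -
    obtain c where "x = comb u (\<lambda>i. 2 * c i)" "even (\<Sum>i\<in>UNIV. c i)"
      using xy(1) by (auto simp: scaled_D_def)
    moreover obtain d where "y = comb u (\<lambda>i. 2 * d i)" "even (\<Sum>i\<in>UNIV. d i)"
      using xy(2) by (auto simp: scaled_D_def)
    ultimately show ?thesis
      using scaled_D_I[of "\<lambda>i. c i - d i" u]
      by (simp add: sum_subtractf right_diff_distrib comb_diff)
  qed
  moreover have "0 \<in> scaled_D u"
    using D[of 0] by simp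
  ultimately show "int_span (range e) \<subseteq> scaled_D u"
    by (intro int_span_minimal) auto
  show "scaled_D u \<subseteq> int_span (range e)"
  proof
    fix x assume "x \<in> scaled_D u"
    then obtain c where c: "x = comb u (\<lambda>i. 2 * c i)" "even (c 1 + c 2 + c 3 + c 4 + c 5)"
      by (auto simp: scaled_D_def sum_5)
    obtain t where t: "c 1 + c 2 + c 3 + c 4 + c 5 = 2 * t" using c(2) by (rule evenE)
    then have t': "c 5 = 2 * t - c 1 - c 2 - c 3 - c 4" by simp
    \<comment> \<open>Comparing coordinates along the chain gives partial sums. At the fork, the
      coefficients of \<open>e 4\<close> and \<open>e 5\<close> add up to
      \<open>c 1 + c 2 + c 3 + c 4\<close>, and the second exceeds the first by \<open>c 5\<close>;
      hence the second is \<open>t\<close>, an integer by the parity condition.\<close>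
    have "x = real_of_int (c 1) *\<^sub>R e 1 + real_of_int (c 1 + c 2) *\<^sub>R e 2
      + real_of_int (c 1 + c 2 + c 3) *\<^sub>R e 3 + real_of_int (c 1 + c 2 + c 3 + c 4 - t) *\<^sub>R e 4
      + real_of_int t *\<^sub>R e 5"
      unfolding c(1) comb_def sum_5 e t'
      by (simp add: algebra_simps) (simp flip: scaleR_left_distrib)
    then show "x \<in> int_span (range e)"
      by (simp only:) (intro int_span_add int_span_scale int_span_base rangeI)
  qed
qed

theorem theorem6p1:
  fixes e :: "5 \<Rightarrow> 'a::euclidean_space" and \<Lambda>\<^sub>5 M :: "'a set" and f\<^sub>1 :: 'a
  assumes "lattice_basis e \<Lambda>\<^sub>5"
    and "gram_matrix e = gram5"
    and "f\<^sub>1 = (1/2) *\<^sub>R (e 1 + 2 *\<^sub>R e 2 + 2 *\<^sub>R e 3 + e 4 + e 5)"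
    and "integral_lattice M"
    and "M \<subseteq> span \<Lambda>\<^sub>5"
    and "\<Lambda>\<^sub>5 \<subseteq> M"
  shows "\<exists>L \<in> {\<Lambda>\<^sub>5,
               adjoin \<Lambda>\<^sub>5 {(1/2) *\<^sub>R e 1},
               adjoin \<Lambda>\<^sub>5 {(1/2) *\<^sub>R (e 1 + e 3)},
               adjoin \<Lambda>\<^sub>5 {(1/2) *\<^sub>R (e 4 + e 5)},
               adjoin \<Lambda>\<^sub>5 {(1/2) *\<^sub>R e 1, (1/2) *\<^sub>R e 3},
               adjoin \<Lambda>\<^sub>5 {(1/2) *\<^sub>R e 1, f\<^sub>1},
               adjoin \<Lambda>\<^sub>5 {(1/2) *\<^sub>R (e 1 + e 3), (1/2) *\<^sub>R (e 4 + e 5)},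
               adjoin \<Lambda>\<^sub>5 {(1/2) *\<^sub>R e 1, (1/2) *\<^sub>R e 3, f\<^sub>1}}. isometric_lattices M L"
proof -
  \<comment> \<open>The frame is found by solving the equations of \<open>scaled_D_5_basis\<close>
    for \<open>u\<close>: sum and difference of \<open>e 4\<close> and \<open>e 5\<close> give
    \<open>u 4\<close> and \<open>u 5\<close>, and the chain is then followed back to
    \<open>u 1\<close>.\<close>
  define u4 where "u4 = (1/4) *\<^sub>R (e 4 + e 5)"
  define u3 where "u3 = (1/2) *\<^sub>R e 3 + u4"
  define u2 where "u2 = (1/2) *\<^sub>R e 2 + u3"
  define u :: "5 \<Rightarrow> 'a" where
    "u = ($) (vector [(1/2) *\<^sub>R e 1 + u2, u2, u3, u4, (1/4) *\<^sub>R (e 5 - e 4)])"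
  have u: "u 1 = (1/2) *\<^sub>R e 1 + u2" "u 2 = u2" "u 3 = u3" "u 4 = u4"
    "u 5 = (1/4) *\<^sub>R (e 5 - e 4)"
    by (simp_all add: u_def vector_5)
  have e: "e 1 = 2 *\<^sub>R (u 1 - u 2)" "e 2 = 2 *\<^sub>R (u 2 - u 3)" "e 3 = 2 *\<^sub>R (u 3 - u 4)"
    "e 4 = 2 *\<^sub>R (u 4 - u 5)" "e 5 = 2 *\<^sub>R (u 4 + u 5)"
    by (simp_all add: u u2_def u3_def u4_def algebra_simps flip: scaleR_left_distrib)
  have gram: "e i \<bullet> e j = gram5 $ i $ j" for i j
    using arg_cong[OF assms(2), of "\<lambda>A. A $ i $ j"] by (simp add: gram_matrix_def)
  have "\<forall>i j. u i \<bullet> u j = (if i = j then 1/2 else 0)"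
    unfolding forall_5 u u2_def u3_def u4_def
    by (simp add: inner_add_left inner_add_right inner_diff_left inner_diff_right gram
        gram5_def vector_5)
  then have half: "half_orthonormal u" by (simp add: half_orthonormal_def)
  have \<Lambda>: "\<Lambda>\<^sub>5 = scaled_D u"
    using assms(1) scaled_D_5_basis[OF e] by (simp add: lattice_basis_def)
  have comb_span: "comb w n \<in> span (range w)" for w :: "5 \<Rightarrow> 'a" and n
    unfolding comb_def by (intro span_sum span_scale span_base) simp
  have D_span: "scaled_D w \<subseteq> span (range w)" for w :: "5 \<Rightarrow> 'a"
    using comb_span by (auto simp: scaled_D_def)
  have M_int: "x \<bullet> y \<in> \<int>" if "x \<in> M" "y \<in> M" for x y
    using assms(4) that by (simp add: integral_lattice_def)
  have M_span: "M \<subseteq> span (range u)"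
    using assms(5) span_minimal[OF D_span subspace_span, of u] \<Lambda> by blast
  have "M \<subseteq> range (comb u)"
  proof
    fix x assume "x \<in> M"
    then show "x \<in> range (comb u)"
      using M_int M_span assms(6) \<Lambda> by (intro integral_coordinates[OF half]) auto
  qed
  moreover have "x - y \<in> M" if "x \<in> M" "y \<in> M" for x y
    using assms(4) that by (auto simp: integral_lattice_def is_lattice_def intro: int_span_diff)
  ultimately have "overlattice u M"
    using half assms(6) \<Lambda> M_int by (simp add: overlattice_def)
  then obtain w :: "5 \<Rightarrow> 'a" and X where w: "half_orthonormal w"
    and M: "M = int_span (scaled_D w \<union> X)"
    and X: "X \<in> {{}, {w 1 - w 2}, {w 1 - w 2 + w 3 - w 4}, {2 *\<^sub>R w 4}, {w 1 - w 2, w 3 - w 4},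
      {w 1 - w 2, w 1 + w 2}, {w 1 - w 2 + w 3 - w 4, 2 *\<^sub>R w 4},
      {w 1 - w 2, w 3 - w 4, w 1 + w 2}}"
    by (rule overlattice_5_normal_form)
  \<comment> \<open>The frame \<open>w\<close> adapted to \<open>M\<close> need not be
    \<open>u\<close>. The linear map from \<open>w\<close> to \<open>u\<close> carries
    \<open>scaled_D w\<close> onto \<open>\<Lambda>\<^sub>5\<close>, so only the image of the extra
    generators \<open>X\<close> remains to be computed.\<close>
  have iso: "isometric_lattices M (adjoin \<Lambda>\<^sub>5 Y)"
    if Y: "\<And>\<phi>. linear \<phi> \<Longrightarrow> (\<And>i. \<phi> (w i) = u i) \<Longrightarrow> \<phi> ` X = Y" for Y
    unfolding M adjoin_def \<Lambda>
  proof (rule isometric_int_span_frames[OF w half])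
    have "w i \<in> span (range w)" for i by (simp add: span_base)
    then have "X \<subseteq> span (range w)"
      using X by (auto intro!: span_add span_diff span_scale)
    then show "scaled_D w \<union> X \<subseteq> span (range w)" using D_span by blast
    fix \<phi> :: "'a \<Rightarrow> 'a" assume \<phi>: "linear \<phi>" "\<And>i. \<phi> (w i) = u i"
    have "\<phi> (comb w n) = comb u n" for n
      by (simp add: comb_def linear_sum[OF \<phi>(1)] linear_scale[OF \<phi>(1)] \<phi>(2))
    then have "\<phi> ` scaled_D w = scaled_D u"
      by (force simp: scaled_D_def image_iff)
    then show "\<phi> ` (scaled_D w \<union> X) = scaled_D u \<union> Y"
      using Y[OF \<phi>] by (simp add: image_Un)
  qed
  have gens: "(1/2) *\<^sub>R e 1 = u 1 - u 2" "(1/2) *\<^sub>R e 3 = u 3 - u 4"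
    "(1/2) *\<^sub>R (e 1 + e 3) = u 1 - u 2 + u 3 - u 4" "(1/2) *\<^sub>R (e 4 + e 5) = 2 *\<^sub>R u 4"
    "f\<^sub>1 = u 1 + u 2"
    unfolding assms(3) e
    by (simp_all add: algebra_simps flip: scaleR_left_distrib)
      (simp add: algebra_simps scaleR_2)
  \<comment> \<open>Gives the case without extra generators the same form as the other
    seven.\<close>
  have \<Lambda>_adjoin: "\<Lambda>\<^sub>5 = adjoin \<Lambda>\<^sub>5 {}"
    using scaled_D_5_basis[OF e] int_span_minimal[of \<Lambda>\<^sub>5 \<Lambda>\<^sub>5] \<Lambda> int_span_base[of _ \<Lambda>\<^sub>5]
      int_span_zero[of "range e"] int_span_diff[of _ "range e"]
    by (auto simp: adjoin_def)
  have map: "\<phi> (w i - w j) = u i - u j" "\<phi> (w i + w j) = u i + u j"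
    "\<phi> (w i - w j + w k - w l) = u i - u j + u k - u l" "\<phi> (2 *\<^sub>R w i) = 2 *\<^sub>R u i"
    if "linear \<phi>" "\<And>i. \<phi> (w i) = u i" for \<phi> i j k l
    using that by (simp_all add: linear_add linear_diff linear_scale)
  have "\<exists>Y \<in> {{}, {u 1 - u 2}, {u 1 - u 2 + u 3 - u 4}, {2 *\<^sub>R u 4}, {u 1 - u 2, u 3 - u 4},
      {u 1 - u 2, u 1 + u 2}, {u 1 - u 2 + u 3 - u 4, 2 *\<^sub>R u 4},
      {u 1 - u 2, u 3 - u 4, u 1 + u 2}}.
      \<forall>\<phi>. linear \<phi> \<longrightarrow> (\<forall>i. \<phi> (w i) = u i) \<longrightarrow> \<phi> ` X = Y"
    using X by (elim insertE emptyE) (simp_all add: map)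
  then obtain Y where "Y \<in> {{}, {u 1 - u 2}, {u 1 - u 2 + u 3 - u 4}, {2 *\<^sub>R u 4},
      {u 1 - u 2, u 3 - u 4}, {u 1 - u 2, u 1 + u 2}, {u 1 - u 2 + u 3 - u 4, 2 *\<^sub>R u 4},
      {u 1 - u 2, u 3 - u 4, u 1 + u 2}}" "isometric_lattices M (adjoin \<Lambda>\<^sub>5 Y)"
    using iso by blast
  then show ?thesis
    unfolding gens by (elim insertE emptyE) (simp_all add: \<Lambda>_adjoin[symmetric])
qed

end
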